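(* Consider a network with routes of length one with numbers of flows $n=(n_i)_{i\in I}$, and let $x=(x_i)_{i\in I}$ be the optimal rate allocation. For each $i\in I$, $$x_i\ \ge\ \min_{J'\subseteq J:\ i\in I(J')}\ \frac{C(J')}{\sum_{i'\in I(J')}n_{i'}}.$$
   Context: Network: $I$ is a finite set of users (flow types), $J$ a finite set of resources, resource $j$ has capacity $C_j>0$, and user $i$ can use exactly the resources in the nonempty set $J(i)\subseteq J$ (each route is a single resource). $n_i\ge0$ is the number of flows of type $i$. Optimal allocation: let $U$ be a strictly concave, strictly increasing, differentiable utility function common to all users. $x=(x_i)_{i\in I}$ is the solution of: maximize $\sum_{i\in I} n_iU(x_i)$ subject to $\sum_{i: j\in J(i)} n_ix_i^j\le C_j$ for all $j\in J$; $\sum_{j\in J(i)}x_i^j=x_i$ for all $i\in I$; $x_i^j\ge 0$ for all $i\in I$, $j\in J(i)$. Convention: $x_i=0$ if $n_i=0$. The allocation does not depend on the choice of $U$. Notation: for $J'\subseteq J$, $C(J')=\sum_{j\in J'}C_j$ and $I(J')=\{i\in I: J(i)\subseteq J'\}$.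
   Formalization: The inequality is stated only for i with n_i > 0; when n_i = 0 the convention x_i = 0 makes it fail, e.g. one resource of capacity 1 and two users with n = (0,1), where x_i = 0 but the minimum is 1. *)

theory Defs
  imports "HOL-Analysis.Analysis"
begin

definition strictly_concave_on :: "real set \<Rightarrow> (real \<Rightarrow> real) \<Rightarrow> bool" where
  "strictly_concave_on D f \<longleftrightarrow> convex D \<and>
     (\<forall>a\<in>D. \<forall>b\<in>D. \<forall>t. a \<noteq> b \<and> 0 < t \<and> t < 1 \<longrightarrow>
        (1 - t) * f a + t * f b < f ((1 - t) * a + t * b))"

(* D is the set of rates at which the utility is finite: [0,\<infinity>), or (0,\<infinity>) for utilities
   such as ln with value -\<infinity> at 0. Differentiability is asked for at positive rates only,
   so that utilities with infinite slope at 0, such as sqrt, are included. *)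
definition utility :: "real set \<Rightarrow> (real \<Rightarrow> real) \<Rightarrow> bool" where
  "utility D U \<longleftrightarrow> (D = {0..} \<or> D = {0<..}) \<and>
     strictly_concave_on D U \<and> strict_mono_on D U \<and> U differentiable_on {0<..}"

(* R i is the set J(i) of resources that user i can use; each of them is a route of length one. *)
definition network :: "'i set \<Rightarrow> 'j set \<Rightarrow> ('i \<Rightarrow> 'j set) \<Rightarrow> ('j \<Rightarrow> real) \<Rightarrow> bool" where
  "network I J R C \<longleftrightarrow> finite I \<and> finite J \<and>
     (\<forall>i\<in>I. R i \<noteq> {} \<and> R i \<subseteq> J) \<and> (\<forall>j\<in>J. 0 < C j)"

(* y i j is the rate, per flow of type i, obtained from resource j. *)
definition feasible ::
  "'i set \<Rightarrow> 'j set \<Rightarrow> ('i \<Rightarrow> 'j set) \<Rightarrow> ('j \<Rightarrow> real) \<Rightarrow> ('i \<Rightarrow> real) \<Rightarrow>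
   ('i \<Rightarrow> real) \<Rightarrow> ('i \<Rightarrow> 'j \<Rightarrow> real) \<Rightarrow> bool" where
  "feasible I J R C n x y \<longleftrightarrow>
     (\<forall>j\<in>J. (\<Sum>i | i \<in> I \<and> j \<in> R i. n i * y i j) \<le> C j) \<and>
     (\<forall>i\<in>I. (\<Sum>j\<in>R i. y i j) = x i) \<and>
     (\<forall>i\<in>I. \<forall>j\<in>R i. 0 \<le> y i j)"

(* The objective must be finite: a rate vector with n i > 0 and x i outside D has objective
   -\<infinity>. Types with n i = 0 contribute nothing to the objective, whatever x i is; the last
   conjunct is the convention that fixes their rate. *)
definition optimal_allocation ::
  "'i set \<Rightarrow> 'j set \<Rightarrow> ('i \<Rightarrow> 'j set) \<Rightarrow> ('j \<Rightarrow> real) \<Rightarrow> ('i \<Rightarrow> real) \<Rightarrow>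
   real set \<Rightarrow> (real \<Rightarrow> real) \<Rightarrow> ('i \<Rightarrow> real) \<Rightarrow> bool" where
  "optimal_allocation I J R C n D U x \<longleftrightarrow>
     is_arg_max (\<lambda>x. \<Sum>i\<in>I. n i * U (x i))
       (\<lambda>x. (\<exists>y. feasible I J R C n x y) \<and> (\<forall>i\<in>I. 0 < n i \<longrightarrow> x i \<in> D)) x \<and>
     (\<forall>i\<in>I. n i = 0 \<longrightarrow> x i = 0)"

definition users_within :: "'i set \<Rightarrow> ('i \<Rightarrow> 'j set) \<Rightarrow> 'j set \<Rightarrow> 'i set" where
  "users_within I R J' = {i \<in> I. R i \<subseteq> J'}"

end

(* Fix an optimal rate vector x, realised by y, and let J' be the set of resources that i reaches
   along alternating paths: the resources of R i, and with any j in J' all resources of each user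
   that draws a positive rate from j. Capacity can be rerouted along such a path, so an unsaturated
   resource in J' would let x i grow, and a user drawing from J' at a rate above x i could cede rate
   to i, which improves the objective by strict concavity. Hence J' is saturated, and only by users
   within J', whose rates are at most x i; therefore C(J') is at most x i times their number. *)
theory Submission
  imports Defs
begin

section \<open>Small perturbations of feasible rates\<close>

lemma eventually_nonneg_affine_at_right:
  fixes a b :: real
  assumes "0 \<le> b" and "a < 0 \<Longrightarrow> 0 < b"
  shows "\<forall>\<^sub>F e in at_right 0. 0 \<le> b + e * a"
proof (cases "a < 0")
  case True
  have "((\<lambda>e. b + e * a) \<longlongrightarrow> b + 0 * a) (at_right 0)"
    by (intro tendsto_intros)
  then have "\<forall>\<^sub>F e in at_right 0. 0 < b + e * a"
    using assms(2)[OF True] by (intro order_tendstoD(1)[where y = "b + 0 * a"]) auto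
  then show ?thesis
    by eventually_elim simp
next
  case False
  have "\<forall>\<^sub>F e::real in at_right 0. 0 < e"
    by (simp add: eventually_at_right_less)
  then show ?thesis
    by eventually_elim (use assms(1) False in auto)
qed

text \<open>Every constraint is affine in the step \<open>e\<close>, and there are finitely many of
  them. A constraint that is tight at \<open>e = 0\<close> survives if its slack does not shrink
  along \<open>d\<close>; one with positive slack survives small steps by continuity. The filter
  form lets further smallness conditions on \<open>e\<close> be added later.\<close>

lemma eventually_feasible_perturbation:
  assumes net: "network I J R C" and y: "feasible I J R C n x y"
    and neg: "\<And>k j. k \<in> I \<Longrightarrow> j \<in> R k \<Longrightarrow> d k j < 0 \<Longrightarrow> 0 < y k j"
    and load: "\<And>j. j \<in> J \<Longrightarrow> 0 < (\<Sum>k | k \<in> I \<and> j \<in> R k. n k * d k j) \<Longrightarrow>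
                 (\<Sum>k | k \<in> I \<and> j \<in> R k. n k * y k j) < C j"
  shows "\<forall>\<^sub>F e in at_right 0. feasible I J R C n
           (\<lambda>k. x k + e * (\<Sum>j\<in>R k. d k j)) (\<lambda>k j. y k j + e * d k j)"
proof -
  have finR: "finite (R k)" if "k \<in> I" for k
    using net that by (auto simp: network_def intro: finite_subset)
  have "\<forall>\<^sub>F e in at_right 0. \<forall>k\<in>I. \<forall>j\<in>R k. 0 \<le> y k j + e * d k j"
    using net y neg finR
    by (intro eventually_ball_finite ballI eventually_nonneg_affine_at_right)
       (auto simp: network_def feasible_def)
  moreover have "\<forall>\<^sub>F e in at_right 0. \<forall>j\<in>J.
      0 \<le> (C j - (\<Sum>k | k \<in> I \<and> j \<in> R k. n k * y k j))
            + e * - (\<Sum>k | k \<in> I \<and> j \<in> R k. n k * d k j)"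
    using net y load
    by (intro eventually_ball_finite ballI eventually_nonneg_affine_at_right)
       (auto simp: network_def feasible_def)
  ultimately show ?thesis
  proof eventually_elim
    case (elim e)
    have "(\<Sum>k | k \<in> I \<and> j \<in> R k. n k * (y k j + e * d k j)) =
        (\<Sum>k | k \<in> I \<and> j \<in> R k. n k * y k j) + e * (\<Sum>k | k \<in> I \<and> j \<in> R k. n k * d k j)" for j
      by (simp add: sum_distrib_left sum.distrib algebra_simps)
    moreover have "(\<Sum>j\<in>R k. y k j + e * d k j) = x k + e * (\<Sum>j\<in>R k. d k j)" if "k \<in> I" for k
      using y that by (simp add: feasible_def sum_distrib_left sum.distrib)
    ultimately show ?case
      using elim by (simp add: feasible_def le_diff_eq add.commute)
  qed
qed

text \<open>Total rate \<open>e\<close> passes from \<open>q\<close> flows at the higher rate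
  \<open>v\<close> to \<open>p\<close> flows at the lower rate \<open>u\<close>. The bounds on
  \<open>e\<close> keep both new rates strictly between \<open>u\<close> and \<open>v\<close>, so
  each lies where \<open>U\<close> is strictly above its chord; on the chord itself the transfer
  would change nothing.\<close>

lemma strictly_concave_on_transfer:
  assumes U: "strictly_concave_on D U" and D: "u \<in> D" "v \<in> D"
    and p: "0 < p" and q: "0 < q" and e: "0 < e" "e / p < v - u" "e / q < v - u"
  shows "p * U u + q * U v < p * U (u + e / p) + q * U (v - e / q)"
proof -
  define L where "L = v - u"
  have "0 < e / p" using e(1) p by simp
  then have L: "0 < L" using e(2) by (simp add: L_def)
  have conc: "(1 - t) * U u + t * U v < U (u + t * L)" if "0 < t" "t < 1" for t
  proof -
    have "(1 - t) * u + t * v = u + t * L"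
      by (simp add: L_def algebra_simps)
    with U D L that show ?thesis
      unfolding strictly_concave_on_def L_def by (metis less_irrefl diff_self)
  qed
  \<comment> \<open>\<open>s\<close> and \<open>t\<close> are the positions of the two new rates on
    the segment from \<open>u\<close> to \<open>v\<close>, as fractions of its length
    \<open>L\<close>.\<close>
  define s where "s = e / (p * L)"
  define t where "t = 1 - e / (q * L)"
  have st: "0 < s" "s < 1" "0 < t" "t < 1"
    using e p q L by (auto simp: s_def t_def L_def[symmetric] field_simps)
  have "p * ((1 - s) * U u + s * U v) < p * U (u + e / p)"
    using conc[of s] st p L by (simp add: s_def)
  moreover have "v - e / q = u + t * L"
    using L q by (simp add: t_def L_def field_simps)
  then have "q * ((1 - t) * U u + t * U v) < q * U (v - e / q)"
    using conc[of t] st q by simp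
  \<comment> \<open>On the chord, the gain of the \<open>p\<close> flows and the loss of the
    \<open>q\<close> flows are both \<open>(e / L) * (U v - U u)\<close>, so they cancel.\<close>
  moreover have "p * ((1 - s) * U u + s * U v) + q * ((1 - t) * U u + t * U v)
      = p * U u + q * U v"
  proof -
    have "p * s = e / L" "q * (1 - t) = e / L"
      using p q L by (auto simp: s_def t_def)
    then have "p * s = q * (1 - t)" by simp
    moreover have "p * ((1 - s) * U u + s * U v) + q * ((1 - t) * U u + t * U v) -
        (p * U u + q * U v) = (p * s - q * (1 - t)) * (U v - U u)"
      by (simp add: algebra_simps)
    ultimately show ?thesis by simp
  qed
  ultimately show ?thesis by linarith
qed

section \<open>Alternating paths and the rate changes along them\<close>

inductive reachable ::
  "'i set \<Rightarrow> ('i \<Rightarrow> 'j set) \<Rightarrow> ('i \<Rightarrow> real) \<Rightarrow> ('i \<Rightarrow> 'j \<Rightarrow> real) \<Rightarrow> 'i \<Rightarrow> 'j \<Rightarrow> bool"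
  for I R n y i where
  base: "j \<in> R i \<Longrightarrow> reachable I R n y i j"
| step: "reachable I R n y i j \<Longrightarrow> k \<in> I \<Longrightarrow> 0 < n k \<Longrightarrow> j \<in> R k \<Longrightarrow> 0 < y k j \<Longrightarrow> l \<in> R k \<Longrightarrow>
         reachable I R n y i l"

text \<open>The factor \<open>1 / n i\<close> makes the flows of type \<open>i\<close> together put
  load one on \<open>j\<close>. This is why a step of \<open>reachable\<close> passes only through
  users with \<open>0 < n k\<close>.\<close>

definition unit_rate :: "('i \<Rightarrow> real) \<Rightarrow> 'i \<Rightarrow> 'j \<Rightarrow> 'i \<Rightarrow> 'j \<Rightarrow> real" where
  "unit_rate n i j = (\<lambda>k l. if k = i \<and> l = j then 1 / n i else 0)"

lemma unit_rate_load:
  assumes "finite I" "i \<in> I" "j \<in> R i" "0 < n i"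
  shows "(\<Sum>k | k \<in> I \<and> l \<in> R k. n k * unit_rate n i j k l) = of_bool (l = j)"
proof -
  have "(\<Sum>k | k \<in> I \<and> l \<in> R k. n k * unit_rate n i j k l) =
      (\<Sum>k | k \<in> I \<and> l \<in> R k. if k = i then of_bool (l = j) else 0)"
    using assms by (intro sum.cong) (auto simp: unit_rate_def)
  then show ?thesis
    using assms by auto
qed

lemma unit_rate_total:
  assumes "finite (R k)" "j \<in> R i"
  shows "(\<Sum>l\<in>R k. unit_rate n i j k l) = of_bool (k = i) / n i"
proof -
  have "(\<Sum>l\<in>R k. unit_rate n i j k l) =
      (\<Sum>l\<in>R k. if l = j then of_bool (k = i) / n i else 0)"
    by (intro sum.cong) (auto simp: unit_rate_def)
  then show ?thesis
    using assms by auto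
qed

(* d reroutes rates so that one additional unit of flow of type i puts its load on j alone. *)
lemma reachable_direction:
  assumes r: "reachable I R n y i j"
    and fin: "finite I" "\<And>k. k \<in> I \<Longrightarrow> finite (R k)" and i: "i \<in> I" "0 < n i"
  obtains d where "\<And>k l. k \<in> I \<Longrightarrow> l \<in> R k \<Longrightarrow> d k l < 0 \<Longrightarrow> 0 < y k l"
    and "\<And>l. (\<Sum>k | k \<in> I \<and> l \<in> R k. n k * d k l) = of_bool (l = j)"
    and "\<And>k. k \<in> I \<Longrightarrow> (\<Sum>l\<in>R k. d k l) = of_bool (k = i) / n i"
proof -
  have "\<exists>d. (\<forall>k\<in>I. \<forall>l\<in>R k. d k l < 0 \<longrightarrow> 0 < y k l) \<and>
      (\<forall>l. (\<Sum>k | k \<in> I \<and> l \<in> R k. n k * d k l) = of_bool (l = j)) \<and>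
      (\<forall>k\<in>I. (\<Sum>l\<in>R k. d k l) = of_bool (k = i) / n i)"
    using r
  proof induction
    case (base j)
    then show ?case
      using unit_rate_load[where R = R] unit_rate_total[where R = R] fin i
      by (intro exI[of _ "unit_rate n i j"]) (auto simp: unit_rate_def)
  next
    case (step j k j')
    then obtain d where d: "\<forall>k\<in>I. \<forall>l\<in>R k. d k l < 0 \<longrightarrow> 0 < y k l"
      "\<forall>l. (\<Sum>k | k \<in> I \<and> l \<in> R k. n k * d k l) = of_bool (l = j)"
      "\<forall>k\<in>I. (\<Sum>l\<in>R k. d k l) = of_bool (k = i) / n i"
      by blast
    \<comment> \<open>User \<open>k\<close> moves one unit of load from \<open>j\<close> to
      \<open>j'\<close>, which leaves its own rate unchanged.\<close>
    let ?d = "\<lambda>a b. d a b + unit_rate n k j' a b - unit_rate n k j a b"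
    have "0 < y a b" if "a \<in> I" "b \<in> R a" "?d a b < 0" for a b
    \<comment> \<open>Only the entry at \<open>k\<close> and \<open>j\<close> is lowered, and there
      \<open>y k j\<close> is positive because the path passes through it.\<close>
    proof (cases "a = k \<and> b = j")
      case False
      then have "?d a b \<ge> d a b"
        using step.hyps by (auto simp: unit_rate_def)
      then show ?thesis using d(1) that by force
    qed (use step.hyps in simp)
    moreover have "(\<Sum>a | a \<in> I \<and> l \<in> R a. n a * ?d a l) = of_bool (l = j')" for l
      using d(2) step.hyps fin
      by (simp add: sum.distrib sum_subtractf ring_distribs unit_rate_load)
    moreover have "(\<Sum>l\<in>R a. ?d a l) = of_bool (a = i) / n i" if "a \<in> I" for a
      using d(3) step.hyps fin that
      by (simp add: sum.distrib sum_subtractf unit_rate_total)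
    ultimately show ?case
      by (intro exI[of _ ?d]) blast
  qed
  then show ?thesis using that by blast
qed

section \<open>What optimality forces on reachable resources\<close>

lemma utility_domain_mono:
  assumes "utility D U" "u \<in> D" "u \<le> v"
  shows "v \<in> D"
  using assms by (auto simp: utility_def)

lemma optimal_allocation_not_less:
  assumes "optimal_allocation I J R C n D U x" and "feasible I J R C n x' y'"
    and "\<And>k. k \<in> I \<Longrightarrow> 0 < n k \<Longrightarrow> x' k \<in> D"
  shows "(\<Sum>k\<in>I. n k * U (x' k)) \<le> (\<Sum>k\<in>I. n k * U (x k))"
  using assms unfolding optimal_allocation_def is_arg_max_def by (meson not_le)

text \<open>Slack at \<open>j\<close> alone suffices to follow the direction of
  \<open>reachable_direction\<close>, since no other load changes. The rate of \<open>i\<close>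
  rises and all other rates stay, against strict monotonicity of \<open>U\<close>.\<close>

lemma reachable_saturated:
  assumes net: "network I J R C" and U: "utility D U"
    and opt: "optimal_allocation I J R C n D U x" and y: "feasible I J R C n x y"
    and i: "i \<in> I" "0 < n i" and r: "reachable I R n y i j"
  shows "C j \<le> (\<Sum>k | k \<in> I \<and> j \<in> R k. n k * y k j)"
proof (rule ccontr)
  assume unsat: "\<not> ?thesis"
  have fin: "finite I" "\<And>k. k \<in> I \<Longrightarrow> finite (R k)"
    using net by (auto simp: network_def intro: finite_subset)
  obtain d where d: "\<And>k l. k \<in> I \<Longrightarrow> l \<in> R k \<Longrightarrow> d k l < 0 \<Longrightarrow> 0 < y k l"
    "\<And>l. (\<Sum>k | k \<in> I \<and> l \<in> R k. n k * d k l) = of_bool (l = j)"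
    "\<And>k. k \<in> I \<Longrightarrow> (\<Sum>l\<in>R k. d k l) = of_bool (k = i) / n i"
    using reachable_direction[OF r fin i] by blast
  have "\<forall>\<^sub>F e in at_right 0. feasible I J R C n
           (\<lambda>k. x k + e * (\<Sum>j\<in>R k. d k j)) (\<lambda>k j. y k j + e * d k j)"
    using unsat d by (intro eventually_feasible_perturbation[OF net y]) (auto split: if_splits)
  moreover have "\<forall>\<^sub>F e::real in at_right 0. 0 < e"
    by (simp add: eventually_at_right_less)
  ultimately have "\<forall>\<^sub>F e in at_right 0. 0 < e \<and> feasible I J R C n
           (\<lambda>k. x k + e * (\<Sum>j\<in>R k. d k j)) (\<lambda>k j. y k j + e * d k j)"
    by eventually_elim simp
  then obtain e :: real where e: "0 < e" and feas: "feasible I J R C n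
      (\<lambda>k. x k + e * (\<Sum>j\<in>R k. d k j)) (\<lambda>k j. y k j + e * d k j)" (is "feasible _ _ _ _ _ ?x _")
    using eventually_happens'[OF trivial_limit_at_right_real] by blast
  have x': "?x k = (if k = i then x i + e / n i else x k)" if "k \<in> I" for k
    using d(3) that by simp
  have D: "x k \<in> D" if "k \<in> I" "0 < n k" for k
    using opt that by (auto simp: optimal_allocation_def is_arg_max_def)
  have D': "?x k \<in> D" if "k \<in> I" "0 < n k" for k
    using D[OF that] U x'[OF that(1)] e that i
    by (intro utility_domain_mono[OF U D[OF that]]) auto
  have "(\<Sum>k\<in>I. n k * U (x k)) < (\<Sum>k\<in>I. n k * U (?x k))"
  proof (rule sum_strict_mono_ex1)
    have "U (x i) < U (?x i)"
      using U D[OF i] D'[OF i] x'[OF i(1)] e i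
      by (auto simp: utility_def strict_mono_on_def)
    then have "n i * U (x i) < n i * U (?x i)"
      using i by simp
    then show "\<exists>k\<in>I. n k * U (x k) < n k * U (?x k)"
      using i by blast
    then show "\<forall>k\<in>I. n k * U (x k) \<le> n k * U (?x k)"
      using \<open>n i * U (x i) < n i * U (?x i)\<close> x' by (metis less_eq_real_def)
  qed (fact fin)
  with optimal_allocation_not_less[OF opt feas D'] show False by simp
qed

text \<open>If \<open>x k\<close> exceeded \<open>x i\<close>, withdrawing from \<open>k\<close> at
  \<open>j\<close> exactly the load that \<open>i\<close> adds there would keep all loads fixed, so
  saturation is no obstacle, and \<open>strictly_concave_on_transfer\<close> would give a better
  objective.\<close>

lemma reachable_rate_le:
  assumes net: "network I J R C" and U: "utility D U"
    and opt: "optimal_allocation I J R C n D U x" and y: "feasible I J R C n x y"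
    and i: "i \<in> I" "0 < n i" and r: "reachable I R n y i j"
    and k: "k \<in> I" "0 < n k" "j \<in> R k" "0 < y k j"
  shows "x k \<le> x i"
proof (rule ccontr)
  assume "\<not> ?thesis"
  then have less: "x i < x k" and ne: "k \<noteq> i" by auto
  have fin: "finite I" "\<And>k. k \<in> I \<Longrightarrow> finite (R k)"
    using net by (auto simp: network_def intro: finite_subset)
  obtain d where d: "\<And>k l. k \<in> I \<Longrightarrow> l \<in> R k \<Longrightarrow> d k l < 0 \<Longrightarrow> 0 < y k l"
    "\<And>l. (\<Sum>k | k \<in> I \<and> l \<in> R k. n k * d k l) = of_bool (l = j)"
    "\<And>k. k \<in> I \<Longrightarrow> (\<Sum>l\<in>R k. d k l) = of_bool (k = i) / n i"
    using reachable_direction[OF r fin i] by blast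
  define d' where "d' = (\<lambda>a l. d a l - unit_rate n k j a l)"
  \<comment> \<open>The withdrawal affects only the entry at \<open>k\<close> and \<open>j\<close>,
    where \<open>y k j\<close> is positive by assumption.\<close>
  have d'_neg: "0 < y a l" if "a \<in> I" "l \<in> R a" "d' a l < 0" for a l
    using d(1)[OF that(1,2)] that(3) k by (auto simp: d'_def unit_rate_def split: if_splits)
  have d'_load: "(\<Sum>a | a \<in> I \<and> l \<in> R a. n a * d' a l) = 0" for l
    using d(2) k fin by (simp add: d'_def sum_subtractf ring_distribs unit_rate_load)
  have d'_total: "(\<Sum>l\<in>R a. d' a l) = of_bool (a = i) / n i - of_bool (a = k) / n k"
    if "a \<in> I" for a
    using d(3) k fin that by (simp add: d'_def sum_subtractf unit_rate_total)
  have "\<forall>\<^sub>F e in at_right 0. feasible I J R C n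
           (\<lambda>k. x k + e * (\<Sum>j\<in>R k. d' k j)) (\<lambda>k j. y k j + e * d' k j)"
    using d'_neg d'_load by (intro eventually_feasible_perturbation[OF net y]) auto
  moreover have "\<forall>\<^sub>F e::real in at_right 0. 0 < e"
    by (simp add: eventually_at_right_less)
  moreover have "\<forall>\<^sub>F e in at_right 0. e / n a < x k - x i" for a
  proof -
    have "((\<lambda>e. e / n a) \<longlongrightarrow> 0 / n a) (at_right 0)"
      unfolding divide_inverse by (intro tendsto_intros)
    then show ?thesis
      using less by (intro order_tendstoD(2)[where y = "0 / n a"]) auto
  qed
  note this[of i] this[of k]
  \<comment> \<open>The two bounds keep both new rates strictly between \<open>x i\<close> and
    \<open>x k\<close>.\<close>
  ultimately have "\<forall>\<^sub>F e in at_right 0. 0 < e \<and> e / n i < x k - x i \<and> e / n k < x k - x i \<and>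
      feasible I J R C n
           (\<lambda>k. x k + e * (\<Sum>j\<in>R k. d' k j)) (\<lambda>k j. y k j + e * d' k j)"
    by eventually_elim simp
  then obtain e :: real where e: "0 < e" "e / n i < x k - x i" "e / n k < x k - x i"
    and feas: "feasible I J R C n
      (\<lambda>k. x k + e * (\<Sum>j\<in>R k. d' k j)) (\<lambda>k j. y k j + e * d' k j)" (is "feasible _ _ _ _ _ ?x _")
    using eventually_happens'[OF trivial_limit_at_right_real] by blast
  have x': "?x i = x i + e / n i" "?x k = x k - e / n k"
    "\<And>a. a \<in> I \<Longrightarrow> a \<noteq> i \<Longrightarrow> a \<noteq> k \<Longrightarrow> ?x a = x a"
    using d'_total i k ne by auto
  have D: "x a \<in> D" if "a \<in> I" "0 < n a" for a
    using opt that by (auto simp: optimal_allocation_def is_arg_max_def)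
  have D': "?x a \<in> D" if "a \<in> I" "0 < n a" for a
  proof -
    \<comment> \<open>Only the rate of \<open>k\<close> drops, and it stays above
      \<open>x i\<close>. As \<open>D\<close> is upward closed and contains \<open>x i\<close>, the
      objective stays finite even if \<open>D\<close> excludes 0.\<close>
    have "?x a = x a \<or> x i \<le> ?x a"
      using x' e i that by (cases "a = i"; cases "a = k") auto
    then show ?thesis
      using D[OF that] utility_domain_mono[OF U D[OF i]] by metis
  qed
  have split: "(\<Sum>a\<in>I. f a) = f i + f k + (\<Sum>a\<in>I - {i, k}. f a)" for f :: "_ \<Rightarrow> real"
    using fin(1) i k ne by (simp add: sum.subset_diff[of "{i, k}" I f])
  have "(\<Sum>a\<in>I. n a * U (x a)) < (\<Sum>a\<in>I. n a * U (?x a))"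
  proof -
    have "(\<Sum>a\<in>I - {i, k}. n a * U (?x a)) = (\<Sum>a\<in>I - {i, k}. n a * U (x a))"
      by (intro sum.cong refl, subst x'(3)) auto
    moreover have "n i * U (x i) + n k * U (x k) < n i * U (?x i) + n k * U (?x k)"
      unfolding x' using U D i k e
      by (intro strictly_concave_on_transfer[where D = D]) (auto simp: utility_def)
    ultimately show ?thesis
      by (simp only: split)
  qed
  with optimal_allocation_not_less[OF opt feas D'] show False by simp
qed

text \<open>With \<open>0 < n i\<close> every denominator in the minimum is positive. For
  \<open>n i = 0\<close> the convention sets \<open>x i = 0\<close>, while the quotients may all be
  positive.\<close>

theorem theorem3p4:
  fixes I :: "'i set" and J :: "'j set" and R :: "'i \<Rightarrow> 'j set" and C :: "'j \<Rightarrow> real"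
    and n :: "'i \<Rightarrow> real" and D :: "real set" and U :: "real \<Rightarrow> real"
    and x :: "'i \<Rightarrow> real" and i :: 'i
  assumes "network I J R C"
    and "\<And>k. k \<in> I \<Longrightarrow> 0 \<le> n k"
    and "utility D U"
    and "optimal_allocation I J R C n D U x"
    and "i \<in> I" and "0 < n i"
  shows "x i \<ge> Min ((\<lambda>J'. (\<Sum>j\<in>J'. C j) / (\<Sum>k\<in>users_within I R J'. n k)) `
                     {J'. J' \<subseteq> J \<and> i \<in> users_within I R J'})"
proof -
  have fin: "finite I" "finite J" and RJ: "\<And>k. k \<in> I \<Longrightarrow> R k \<subseteq> J"
    using assms(1) by (auto simp: network_def)
  obtain y where y: "feasible I J R C n x y"
    using assms(4) by (auto simp: optimal_allocation_def is_arg_max_def)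
  have y_nonneg: "0 \<le> y k j" if "k \<in> I" "j \<in> R k" for k j
    using y that by (auto simp: feasible_def)
  have x_eq: "x k = (\<Sum>j\<in>R k. y k j)" if "k \<in> I" for k
    using y that by (auto simp: feasible_def)
  \<comment> \<open>Makes the bound \<open>n k * x i\<close> valid also for users within
    \<open>J'\<close> that put no load on \<open>J'\<close>.\<close>
  have xi: "0 \<le> x i"
    using assms(5) y_nonneg by (auto simp: x_eq intro: sum_nonneg)
  define J' where "J' = {j. reachable I R n y i j}"
  let ?W = "users_within I R J'"
  have "j \<in> J" if "reachable I R n y i j" for j
    using that RJ assms(5) by induction auto
  then have J': "J' \<subseteq> J" by (auto simp: J'_def)
  have iW: "i \<in> ?W"
    using assms(5) by (auto simp: users_within_def J'_def intro: reachable.base)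
  have finJ': "finite J'" using J' fin finite_subset by blast
  \<comment> \<open>A user that loads some resource of \<open>J'\<close> has all its resources in
    \<open>J'\<close> by closure under \<open>reachable.step\<close>, so its load on
    \<open>J'\<close> is its whole \<open>n k * x k\<close>. Any other user contributes
    zero.\<close>
  have share: "(\<Sum>j | j \<in> J' \<and> j \<in> R k. n k * y k j) \<le> (if k \<in> ?W then n k * x i else 0)"
    if k: "k \<in> I" for k
  proof (cases "\<exists>j\<in>J'. j \<in> R k \<and> n k * y k j \<noteq> 0")
    case True
    then obtain j where j: "reachable I R n y i j" "j \<in> R k" "n k \<noteq> 0" "y k j \<noteq> 0"
      by (auto simp: J'_def)
    then have pos: "0 < n k" "0 < y k j"
      using assms(2)[OF k] y_nonneg[OF k] by (auto simp: less_le)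
    then have "R k \<subseteq> J'"
      using j k by (auto simp: J'_def intro: reachable.step)
    then have "{j. j \<in> J' \<and> j \<in> R k} = R k" and "k \<in> ?W"
      using k by (auto simp: users_within_def)
    moreover have "x k \<le> x i"
      using reachable_rate_le[OF assms(1,3,4) y assms(5,6) j(1) k pos(1) j(2) pos(2)] .
    ultimately show ?thesis
      using pos k by (simp add: x_eq flip: sum_distrib_left)
  next
    case False
    then show ?thesis
      using xi assms(2)[OF k] by (subst sum.neutral) auto
  qed
  have "(\<Sum>j\<in>J'. C j) \<le> (\<Sum>j\<in>J'. \<Sum>k | k \<in> I \<and> j \<in> R k. n k * y k j)"
    using reachable_saturated[OF assms(1,3,4) y assms(5,6)]
    by (intro sum_mono) (auto simp: J'_def)
  \<comment> \<open>Double counting: the load on \<open>J'\<close> is summed by user instead of by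
    resource.\<close>
  also have "\<dots> = (\<Sum>k\<in>I. \<Sum>j | j \<in> J' \<and> j \<in> R k. n k * y k j)"
    using finJ' fin(1) by (rule sum.swap_restrict)
  also have "\<dots> \<le> (\<Sum>k\<in>I. if k \<in> ?W then n k * x i else 0)"
    using share by (rule sum_mono)
  also have "\<dots> = (\<Sum>k\<in>?W. n k) * x i"
    using fin(1) by (simp add: sum_distrib_right users_within_def sum.If_cases Int_def)
  finally have le: "(\<Sum>j\<in>J'. C j) \<le> (\<Sum>k\<in>?W. n k) * x i" .
  have "0 < (\<Sum>k\<in>?W. n k)"
    using fin(1) iW assms(2,6) by (intro sum_pos2[of _ i]) (auto simp: users_within_def)
  then have "(\<Sum>j\<in>J'. C j) / (\<Sum>k\<in>?W. n k) \<le> x i"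
    using le by (simp add: divide_le_eq mult.commute)
  moreover have "finite {J'. J' \<subseteq> J \<and> i \<in> users_within I R J'}"
    using fin(2) by simp
  \<comment> \<open>\<open>J'\<close> is one of the sets over which the minimum runs, so its
    quotient bounds the minimum from above.\<close>
  ultimately show ?thesis
    using J' iW by (intro Min.coboundedI[THEN order_trans]) auto
qed

end
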